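(* Assume OCA (the Open Coloring Axiom). Let $G$ be a topological group whose underlying topological space is cometrizable. Then $G$ is cosmic if and only if $G$ has countable spread, i.e. $s(G)\le\omega$.
   Context: A topological space $X$ is cosmic if it is a continuous image of a separable metrizable space. A topological space $X$ is cometrizable if $X$ admits a weaker (i.e. coarser, not necessarily strictly) metrizable topology such that each point of $X$ has a neighborhood base in the original topology of $X$ (consisting of not necessarily open neighborhoods) whose members are closed in the metrizable topology. For a topological space $Y$, the spread of $Y$ is the cardinal $s(Y)=\sup\{|D| : D\subset Y \text{ is a discrete subspace of } Y\}$. OCA (the Open Coloring Axiom, in Todorčević's form) is the following statement: for every separable metrizable space $S$ and every partition $[S]^2=K_0\cup K_1$ of the set of two-element subsets of $S$ such that $\{(x,y)\in S\times S: x\ne y,\ \{x,y\}\in K_0\}$ is open in $S\times S$, either there is an uncountable set $Y\subset S$ with $[Y]^2\subset K_0$, or $S=\bigcup_{n\in\omega}S_n$ for some sets $S_n$ with $[S_n]^2\subset K_1$ for all $n\in\omega$. *)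

theory Defs
  imports
    "HOL-Analysis.Analysis"
    "HOL-Library.Ramsey"
    "HOL-Library.Countable_Set_Type"
begin

unbundle cardinal_syntax

lemma separable_metrizable_lepoll_real:
  assumes "metrizable_space X" "separable_space X"
  shows "topspace X \<lesssim> (UNIV :: real set)"
proof -
  obtain M d where M: "Metric_space M d" and X: "X = Metric_space.mtopology M d"
    using assms(1) by (auto simp: metrizable_space_def)
  interpret Metric_space M d by (rule M)
  obtain C where C: "countable C" "C \<subseteq> M" "X closure_of C = M"
    using assms(2) X by (auto simp: separable_space_def)
  define h where "h x = to_nat_on (C \<times> (UNIV::nat set)) ` 
      {(c, k). c \<in> C \<and> d c x < 1 / real (Suc k)}" for x
  have inj_nat: "inj_on (to_nat_on (C \<times> (UNIV::nat set))) (C \<times> UNIV)"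
    using C(1) by (intro inj_on_to_nat_on) auto
  have "inj_on h M"
  proof (rule inj_onI, rule ccontr)
    fix x y assume xy: "x \<in> M" "y \<in> M" "h x = h y" "x \<noteq> y"
    then have "d x y > 0" by simp
    then obtain k :: nat where k: "1 / real (Suc k) < d x y / 2"
      using nat_approx_posE[of "d x y / 2"] by auto
    have "x \<in> X closure_of C" using C xy by simp
    then obtain c where c: "c \<in> C" "c \<in> mball x (1 / real (Suc k))"
      unfolding X metric_closure_of by auto
        (metis of_nat_0_less_iff of_nat_Suc zero_less_Suc zero_less_divide_1_iff)
    then have cx: "d c x < 1 / real (Suc k)" by (simp add: commute)
    have "{(c, k). c \<in> C \<and> d c x < 1 / real (Suc k)} = {(c, k). c \<in> C \<and> d c y < 1 / real (Suc k)}"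
      using xy(3) inj_on_image_eq_iff[OF inj_nat] unfolding h_def
      by (metis (no_types, lifting) SigmaI UNIV_I case_prodD mem_Collect_eq old.prod.exhaust subsetI)
    then have cy: "d c y < 1 / real (Suc k)" using c cx by auto
    have "d x y \<le> d x c + d c y" using triangle xy C c by blast
    then show False using cx cy k by (simp add: commute)
  qed
  then have "M \<lesssim> (UNIV :: nat set set)" by (auto simp: lepoll_def)
  also have "\<dots> \<lesssim> (UNIV :: real set)" using nat_sets_eqpoll_reals eqpoll_imp_lepoll by blast
  finally show ?thesis using X by simp
qed

text \<open>HOL cannot quantify over types inside a formula. Every separable metrizable space has at most
  continuum many points, so all of them occur, up to homeomorphism, on subsets of \<^typ>\<open>real\<close> carrying
  an arbitrary (not the Euclidean) topology.\<close>

lemma separable_metrizable_real_model: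
  assumes "metrizable_space X" "separable_space X"
  obtains Y :: "real topology" where "metrizable_space Y" "separable_space Y" "X homeomorphic_space Y"
proof -
  obtain f :: "'a \<Rightarrow> real" where f: "inj_on f (topspace X)"
    using separable_metrizable_lepoll_real[OF assms] by (auto simp: lepoll_def)
  define g where "g = inv_into (topspace X) f"
  define Y where "Y = pullback_topology (f ` topspace X) g X"
  have gf: "g (f x) = x" if "x \<in> topspace X" for x
    using f that by (simp add: g_def)
  have top: "topspace Y = f ` topspace X"
    using gf by (auto simp: Y_def topspace_pullback_topology)
  have "continuous_map X Y f"
    unfolding Y_def
  proof (rule continuous_map_pullback')
    show "continuous_map X X (g \<circ> f)"
      by (rule continuous_map_eq[OF continuous_map_id]) (simp add: gf)
    show "topspace X \<subseteq> f -` f ` topspace X" by blast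
  qed
  moreover have "continuous_map Y X g"
    unfolding Y_def using continuous_map_pullback[of X X id] by simp
  ultimately have "homeomorphic_maps X Y f g"
    using gf by (auto simp: homeomorphic_maps_def top)
  then have "X homeomorphic_space Y" by (auto simp: homeomorphic_space_def)
  with assms that show ?thesis
    by (metis homeomorphic_metrizable_space homeomorphic_separable_space)
qed

definition open_coloring_property :: "'a topology \<Rightarrow> bool" where
  "open_coloring_property S \<longleftrightarrow>
    (\<forall>K0 K1. K0 \<union> K1 = [topspace S]\<^bsup>2\<^esup> \<and> K0 \<inter> K1 = {} \<and>
        openin (prod_topology S S)
          {(x, y). x \<in> topspace S \<and> y \<in> topspace S \<and> x \<noteq> y \<and> {x, y} \<in> K0} \<longrightarrow>
      (\<exists>Y \<subseteq> topspace S. uncountable Y \<and> [Y]\<^bsup>2\<^esup> \<subseteq> K0) \<or>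
      (\<exists>T :: nat \<Rightarrow> 'a set. topspace S = (\<Union>n. T n) \<and> (\<forall>n. [T n]\<^bsup>2\<^esup> \<subseteq> K1)))"

definition OCA :: bool where
  "OCA \<longleftrightarrow> (\<forall>S :: real topology. metrizable_space S \<and> separable_space S \<longrightarrow> open_coloring_property S)"

lemma nsets_2_image:
  assumes "e \<in> [g ` A]\<^bsup>2\<^esup>"
  obtains e' where "e' \<in> [A]\<^bsup>2\<^esup>" "e = g ` e'"
proof -
  obtain u v where "u \<noteq> v" "e = {u, v}" "u \<in> g ` A" "v \<in> g ` A"
    using assms by (auto simp: nsets_def card_2_iff)
  then obtain a b where "a \<in> A" "b \<in> A" "u = g a" "v = g b" by blast
  with \<open>u \<noteq> v\<close> \<open>e = {u, v}\<close> show ?thesis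
    by (intro that[of "{a, b}"]) (auto simp: nsets_def card_2_iff)
qed

lemma open_coloring_property_transfer:
  assumes Y: "open_coloring_property Y" and g: "continuous_map Y X g"
    and bij: "bij_betw g (topspace Y) (topspace X)"
  shows "open_coloring_property X"
  unfolding open_coloring_property_def
proof (intro allI impI, elim conjE)
  fix K0 K1 assume K: "K0 \<union> K1 = [topspace X]\<^bsup>2\<^esup>" "K0 \<inter> K1 = {}"
    and op: "openin (prod_topology X X)
          {(x, y). x \<in> topspace X \<and> y \<in> topspace X \<and> x \<noteq> y \<and> {x, y} \<in> K0}" (is "openin _ ?O")
  define L0 where "L0 = {e \<in> [topspace Y]\<^bsup>2\<^esup>. g ` e \<in> K0}"
  define L1 where "L1 = {e \<in> [topspace Y]\<^bsup>2\<^esup>. g ` e \<in> K1}"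
  have inj: "inj_on g (topspace Y)" and im: "g ` topspace Y = topspace X"
    using bij by (auto simp: bij_betw_def)
  have imY: "g ` e \<in> [topspace X]\<^bsup>2\<^esup>" if "e \<in> [topspace Y]\<^bsup>2\<^esup>" for e
    using that im card_image[OF inj_on_subset[OF inj], of e] by (auto simp: nsets_def)
  have L: "L0 \<union> L1 = [topspace Y]\<^bsup>2\<^esup>" "L0 \<inter> L1 = {}"
    using K imY by (auto simp: L0_def L1_def)
  have "continuous_map (prod_topology Y Y) (prod_topology X X) (\<lambda>p. (g (fst p), g (snd p)))"
    by (intro continuous_map_pairedI continuous_map_compose[OF _ g, unfolded o_def]
        continuous_map_fst continuous_map_snd)
  from openin_continuous_map_preimage[OF this op]
  have "openin (prod_topology Y Y) {p \<in> topspace (prod_topology Y Y). (g (fst p), g (snd p)) \<in> ?O}" .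
  also have "{p \<in> topspace (prod_topology Y Y). (g (fst p), g (snd p)) \<in> ?O}
    = {(x, y). x \<in> topspace Y \<and> y \<in> topspace Y \<and> x \<noteq> y \<and> {x, y} \<in> L0}"
    using inj im by (auto simp: L0_def nsets_def inj_on_eq_iff)
  finally have opY: "openin (prod_topology Y Y)
    {(x, y). x \<in> topspace Y \<and> y \<in> topspace Y \<and> x \<noteq> y \<and> {x, y} \<in> L0}" .
  have "(\<exists>A \<subseteq> topspace Y. uncountable A \<and> [A]\<^bsup>2\<^esup> \<subseteq> L0) \<or>
      (\<exists>T :: nat \<Rightarrow> _ set. topspace Y = (\<Union>n. T n) \<and> (\<forall>n. [T n]\<^bsup>2\<^esup> \<subseteq> L1))"
    by (rule Y[unfolded open_coloring_property_def, rule_format]) (intro conjI L opY)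
  then consider (a) A where "A \<subseteq> topspace Y" "uncountable A" "[A]\<^bsup>2\<^esup> \<subseteq> L0"
    | (b) T :: "nat \<Rightarrow> _ set" where "topspace Y = (\<Union>n. T n)" "\<forall>n. [T n]\<^bsup>2\<^esup> \<subseteq> L1"
    by (elim disjE exE conjE) simp_all
  then show "(\<exists>Y \<subseteq> topspace X. uncountable Y \<and> [Y]\<^bsup>2\<^esup> \<subseteq> K0) \<or>
      (\<exists>T :: nat \<Rightarrow> _ set. topspace X = (\<Union>n. T n) \<and> (\<forall>n. [T n]\<^bsup>2\<^esup> \<subseteq> K1))"
  proof cases
    case a
    have "uncountable (g ` A)"
      using a countable_image_inj_eq[OF inj_on_subset[OF inj]] by blast
    moreover have "[g ` A]\<^bsup>2\<^esup> \<subseteq> K0"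
      using a(3) by (auto simp: L0_def elim!: nsets_2_image)
    moreover have "g ` A \<subseteq> topspace X" using a(1) im by blast
    ultimately show ?thesis by (intro disjI1 exI[of _ "g ` A"] conjI)
  next
    case b
    have "[g ` T n]\<^bsup>2\<^esup> \<subseteq> K1" for n
      using b(2) by (auto simp: L1_def elim!: nsets_2_image)
    moreover have "topspace X = (\<Union>n. g ` T n)"
      by (simp add: im[symmetric] b(1) image_UN)
    ultimately show ?thesis by (intro disjI2 exI[of _ "\<lambda>n. g ` T n"] conjI allI)
  qed
qed

lemma OCA_imp_open_coloring_property:
  assumes OCA "metrizable_space X" "separable_space X"
  shows "open_coloring_property X"
proof -
  obtain Y :: "real topology" where Y: "metrizable_space Y" "separable_space Y" "X homeomorphic_space Y"
    using separable_metrizable_real_model assms by blast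
  then obtain f g where "homeomorphic_maps Y X g f"
    by (meson homeomorphic_space_def homeomorphic_space_sym)
  then have "homeomorphic_map Y X g" using homeomorphic_map_maps by blast
  moreover have "open_coloring_property Y" using assms(1) Y by (auto simp: OCA_def)
  ultimately show ?thesis
    using open_coloring_property_transfer
    by (metis bij_betw_def homeomorphic_imp_continuous_map homeomorphic_imp_injective_map
        homeomorphic_imp_surjective_map)
qed

definition cosmic_space :: "'a topology \<Rightarrow> bool" where
  "cosmic_space X \<longleftrightarrow> (\<exists>(Z :: real topology) f. metrizable_space Z \<and> separable_space Z \<and>
     continuous_map Z X f \<and> f ` topspace Z = topspace X)"

lemma cosmic_spaceI:
  fixes Z :: "'b topology"
  assumes "metrizable_space Z" "separable_space Z" "continuous_map Z X f" "f ` topspace Z = topspace X"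
  shows "cosmic_space X"
proof -
  obtain Y :: "real topology" where Y: "metrizable_space Y" "separable_space Y" "Z homeomorphic_space Y"
    using separable_metrizable_real_model assms by blast
  then obtain g where "homeomorphic_map Y Z g"
    by (meson homeomorphic_space homeomorphic_space_sym)
  then have "continuous_map Y Z g" "g ` topspace Y = topspace Z"
    by (auto simp: homeomorphic_imp_continuous_map homeomorphic_imp_surjective_map)
  then have "continuous_map Y X (f \<circ> g)" "(f \<circ> g) ` topspace Y = topspace X"
    using assms continuous_map_compose by (blast, simp only: image_comp[symmetric])
  then show ?thesis using Y cosmic_space_def by blast
qed

text \<open>The sets \<open>V\<close> in \<^const>\<open>neighbourhood_base_of\<close> need not be open.\<close>

definition cometrizable_space :: "'a topology \<Rightarrow> bool" where
  "cometrizable_space X \<longleftrightarrow> (\<exists>M. metrizable_space M \<and> topspace M = topspace X \<and>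
     (\<forall>U. openin M U \<longrightarrow> openin X U) \<and> neighbourhood_base_of (closedin M) X)"

text \<open>The set of cardinals is ordered by the library's order on well-order relations. Every discrete
  subspace has at most as many points as the type, so the supremum of their cardinalities is
  represented by a cardinal order on the type itself.\<close>

definition spread_bounds :: "'a topology \<Rightarrow> 'a rel set" where
  "spread_bounds X = {\<kappa>. Card_order \<kappa> \<and>
     (\<forall>D. D \<subseteq> topspace X \<and> subtopology X D = discrete_topology D \<longrightarrow> |D| \<le>o \<kappa>)}"

definition spread :: "'a topology \<Rightarrow> 'a rel" where
  "spread X = (SOME \<kappa>. \<kappa> \<in> spread_bounds X \<and> (\<forall>\<kappa>' \<in> spread_bounds X. \<kappa> \<le>o \<kappa>'))"

lemma spread_least_bound:
  shows "spread X \<in> spread_bounds X" and "\<kappa> \<in> spread_bounds X \<Longrightarrow> spread X \<le>o \<kappa>"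
proof -
  have "|UNIV| \<in> spread_bounds X"
    by (auto simp: spread_bounds_def card_of_Card_order card_of_mono1)
  then have "spread_bounds X \<noteq> {}" by blast
  moreover have "\<forall>\<kappa> \<in> spread_bounds X. Card_order \<kappa>" by (simp add: spread_bounds_def)
  ultimately have "\<exists>\<kappa> \<in> spread_bounds X. \<forall>\<kappa>' \<in> spread_bounds X. \<kappa> \<le>o \<kappa>'"
    by (rule exists_minim_Card_order)
  from someI_ex[OF this[unfolded Bex_def]]
  show "spread X \<in> spread_bounds X" and "\<kappa> \<in> spread_bounds X \<Longrightarrow> spread X \<le>o \<kappa>"
    unfolding spread_def[symmetric] by blast+
qed

lemma spread_le_natLeq_iff:
  "spread X \<le>o natLeq \<longleftrightarrow>
    (\<forall>D. D \<subseteq> topspace X \<and> subtopology X D = discrete_topology D \<longrightarrow> countable D)"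
proof
  assume "spread X \<le>o natLeq"
  then have "|D| \<le>o natLeq" if "D \<subseteq> topspace X \<and> subtopology X D = discrete_topology D" for D
    using spread_least_bound(1)[of X] that by (auto simp: spread_bounds_def intro: ordLeq_transitive)
  then show "\<forall>D. D \<subseteq> topspace X \<and> subtopology X D = discrete_topology D \<longrightarrow> countable D"
    by (simp add: countable_card_le_natLeq)
next
  assume *: "\<forall>D. D \<subseteq> topspace X \<and> subtopology X D = discrete_topology D \<longrightarrow> countable D"
  have "\<exists>B :: 'a set. countable B \<and> (\<forall>D :: 'a set. countable D \<longrightarrow> |D| \<le>o |B| )"
  proof (cases "finite (UNIV :: 'a set)")
    case True
    then show ?thesis
      by (intro exI[of _ UNIV]) (auto intro: card_of_mono1 countable_finite)
  next
    case False
    then obtain B :: "'a set" where B: "infinite B" "countable B"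
      using infinite_countable_subset' by blast
    have "|D| \<le>o |B|" if "countable D" for D :: "'a set"
    proof (rule ordLeq_transitive)
      show "|D| \<le>o natLeq" using that by (simp add: countable_card_le_natLeq)
      show "natLeq \<le>o |B|" using B(1) infinite_iff_natLeq_ordLeq[of B] by blast
    qed
    with B show ?thesis by blast
  qed
  then obtain B :: "'a set" where B: "countable B" "\<And>D :: 'a set. countable D \<Longrightarrow> |D| \<le>o |B|"
    by blast
  have "|B| \<in> spread_bounds X"
    using * B(2) by (simp add: spread_bounds_def card_of_Card_order)
  then have "spread X \<le>o |B|" by (rule spread_least_bound)
  moreover have "|B| \<le>o natLeq" using B(1) by (simp add: countable_card_le_natLeq)
  ultimately show "spread X \<le>o natLeq" by (rule ordLeq_transitive)
qed

text \<open>Topological groups are the instances of \<^class>\<open>topological_group_add\<close>: the additive notation there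
  does not imply commutativity, and no separation axiom is assumed.\<close>

end

theory Submission
  imports Defs
begin

text \<open>A cosmic space has a countable base on a separable metrizable preimage, and a discrete subset
  injects into that base; this is the easy direction.

  Conversely, let \<open>G\<close> be a cometrizable group with countable spread and let \<open>M\<close> be the coarser
  metrizable topology. Sets discrete in \<open>M\<close> are discrete in \<open>G\<close>, so \<open>M\<close> is second countable. Hence a
  point \<open>x\<close> avoiding an \<open>M\<close>-closed set \<open>C\<close> is an open relation between \<open>x\<close> and \<open>C\<close> for a second countable
  topology on any family of such points and sets (\<open>avoidance_topology\<close>), and OCA applies to every
  coloring built from this relation (\<open>OCA_dichotomy\<close>).

  Color two pairs \<open>(x, C)\<close>, \<open>(y, D)\<close> of a point with an \<open>M\<close>-closed neighbourhood of it by whether \<open>x \<notin> D\<close>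
  or \<open>y \<notin> C\<close>. If all pairs split into countably many pieces where this fails, the sets of points of
  the pieces form a countable network: within a piece every point lies in every neighbourhood. A
  countable network makes \<open>G\<close> cosmic. Otherwise there is an uncountable weakly separated set \<open>Y\<close>, with
  neighbourhoods \<open>F y\<close> such that \<open>y \<notin> F z\<close> or \<open>z \<notin> F y\<close> for all distinct \<open>y, z\<close>; a typical example is an
  uncountable subset of the Sorgenfrey line, with \<open>F y\<close> a half-line starting at \<open>y\<close>. The rest of the
  proof produces an uncountable discrete subset of \<open>G\<close> from \<open>Y\<close>
  (\<open>weakly_separated_imp_countable\<close>).

  In the Sorgenfrey example the graph of a strictly decreasing function is discrete in the square.
  OCA provides such a function: color the points of \<open>Y \<times> Y\<close> by strict decrease. A countable cover of
  \<open>Y \<times> Y\<close> by increasing relations is impossible, because one of them would have nondegenerate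
  vertical sections over uncountably many points, and these sections would span uncountably many
  nonoverlapping intervals. The same argument works for weakly separated sets
  (\<open>uncountable_reversing_pairs\<close>). Finally the group operation maps the graph into \<open>G\<close>: the sums
  \<open>a + b\<close> of the selected pairs form a discrete set. If \<open>a' + b'\<close> is close to \<open>a + b\<close> and one of
  \<open>a'\<close>, \<open>b'\<close> is close to its counterpart, then so is the other; but one coordinate moves into the
  neighbourhood and the other one moves out of it. That the first coordinate which moves in comes
  close enough is arranged by two more applications of OCA (\<open>uncountable_comparable_subfamily\<close>).\<close>

section \<open>Second countable topologies and open relations\<close>

lemma uncountable_fiber:
  assumes "uncountable X" "countable K" "\<And>x. x \<in> X \<Longrightarrow> g x \<in> K"
  obtains k where "uncountable {x \<in> X. g x = k}"
proof -
  have "X = (\<Union>k\<in>K. {x \<in> X. g x = k})"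
    using assms(3) by blast
  then show ?thesis
    using assms(1,2) that countable_UN[of K "\<lambda>k. {x \<in> X. g x = k}"] by fastforce
qed

lemma uncountable_two_points:
  assumes "uncountable X"
  obtains x y where "x \<in> X" "y \<in> X" "x \<noteq> y"
proof -
  obtain x where x: "x \<in> X"
    using assms by fastforce
  have "X \<noteq> {x}"
    using assms by auto
  with x that show ?thesis by blast
qed

lemma open_coordinate_greater: "open {u :: nat \<Rightarrow> real. a < u k}"
proof -
  have "open ((\<lambda>u :: nat \<Rightarrow> real. u k) -` {a<..})"
    by (rule open_vimage[OF open_greaterThan continuous_on_product_coordinates])
  then show ?thesis
    by (simp add: vimage_def)
qed

lemma separable_metrizable_codes:
  fixes S :: "(nat \<Rightarrow> real) set"
  shows "metrizable_space (top_of_set S)" "separable_space (top_of_set S)"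
proof -
  have "second_countable (euclidean :: (nat \<Rightarrow> real) topology)"
  proof -
    obtain \<B> :: "(nat \<Rightarrow> real) set set"
      where B: "countable \<B>" "\<And>C. C \<in> \<B> \<Longrightarrow> open C" "\<And>S. open S \<Longrightarrow> \<exists>U\<subseteq>\<B>. S = \<Union>U"
      using univ_second_countable by metis
    have "\<exists>V\<in>\<B>. x \<in> V \<and> V \<subseteq> U" if "open U" "x \<in> U" for U x
      using B(3)[OF that(1)] that(2) by blast
    then show ?thesis
      unfolding second_countable_def open_openin[symmetric]
      using B(1,2) by (intro exI[of _ \<B>]) simp
  qed
  then show "separable_space (top_of_set S)"
    by (intro second_countable_imp_separable_space second_countable_subtopology)
  show "metrizable_space (top_of_set S)"
    by (intro metrizable_space_subtopology metrizable_space_euclidean)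
qed

text \<open>The topology is pulled back along the map to sequences of zeros and ones that records which of
  the given sets contain a point, so it inherits a countable base.\<close>

lemma second_countable_with_open_sets:
  fixes I :: "'i set"
  assumes "countable \<S>"
  obtains Z where "topspace Z = I" "second_countable Z" "\<And>A. A \<in> \<S> \<Longrightarrow> openin Z (I \<inter> A)"
proof -
  define A where "A = from_nat_into (insert UNIV \<S>)"
  have A: "range A = insert UNIV \<S>"
    using assms by (simp add: A_def range_from_nat_into)
  define c :: "'i \<Rightarrow> nat \<Rightarrow> real" where "c p k = (if p \<in> A k then 1 else 0)" for p k
  define Z where "Z = pullback_topology I c euclidean"
  have top: "topspace Z = I"
    by (simp add: Z_def topspace_pullback_topology)
  obtain \<B> :: "(nat \<Rightarrow> real) set set"
    where B: "countable \<B>" "\<And>C. C \<in> \<B> \<Longrightarrow> open C" "\<And>S. open S \<Longrightarrow> \<exists>U\<subseteq>\<B>. S = \<Union>U"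
    using univ_second_countable by metis
  have "second_countable Z"
    unfolding second_countable_def
  proof (intro exI[of _ "(\<lambda>C. c -` C \<inter> I) ` \<B>"] conjI ballI allI impI)
    fix U p assume "openin Z U \<and> p \<in> U"
    then obtain W where W: "open W" "U = c -` W \<inter> I" "p \<in> U"
      by (auto simp: Z_def openin_pullback_topology)
    then obtain C where C: "C \<in> \<B>" "c p \<in> C" "C \<subseteq> W"
      using B(3)[of W] by blast
    show "\<exists>V\<in>(\<lambda>C. c -` C \<inter> I) ` \<B>. p \<in> V \<and> V \<subseteq> U"
      using C W by (intro bexI[of _ "c -` C \<inter> I"] imageI) auto
  next
    show "countable ((\<lambda>C. c -` C \<inter> I) ` \<B>)"
      using B(1) by (rule countable_image)
    fix V assume "V \<in> (\<lambda>C. c -` C \<inter> I) ` \<B>"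
    then obtain C where C: "C \<in> \<B>" "V = c -` C \<inter> I"
      by (rule imageE)
    then show "openin Z V"
      unfolding Z_def openin_pullback_topology using B(2)[OF C(1)] open_openin by blast
  qed
  moreover have "openin Z (I \<inter> T)" if "T \<in> \<S>" for T
  proof -
    have "T \<in> range A"
      using A that by simp
    then obtain k where k: "T = A k"
      by (rule rangeE)
    have "open {u :: nat \<Rightarrow> real. u k > 1/2}"
      by (rule open_coordinate_greater)
    moreover have "I \<inter> T = c -` {u. u k > 1/2} \<inter> I"
      using k by (auto simp: c_def split: if_splits)
    ultimately show ?thesis
      unfolding Z_def openin_pullback_topology open_openin[symmetric] by blast
  qed
  ultimately show ?thesis
    using that top by blast
qed

lemma second_countable_baseE:
  assumes "second_countable X"
  obtains \<B> where "countable \<B>" "\<And>V. V \<in> \<B> \<Longrightarrow> openin X V"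
    "\<And>U x. openin X U \<Longrightarrow> x \<in> U \<Longrightarrow> \<exists>V\<in>\<B>. x \<in> V \<and> V \<subseteq> U"
proof -
  obtain \<B> where "countable \<B> \<and> (\<forall>V \<in> \<B>. openin X V) \<and>
      (\<forall>U x. openin X U \<and> x \<in> U \<longrightarrow> (\<exists>V \<in> \<B>. x \<in> V \<and> V \<subseteq> U))"
    using assms unfolding second_countable_def by (rule exE)
  then show ?thesis
    by (intro that[of \<B>]) simp_all
qed

lemma openin_prod_rectangleE:
  assumes "openin (prod_topology X Y) W" "(x, y) \<in> W"
  obtains U V where "openin X U" "openin Y V" "x \<in> U" "y \<in> V" "U \<times> V \<subseteq> W"
  using assms(1)[unfolded openin_prod_topology_alt, rule_format, OF assms(2)] that
  by (elim exE conjE)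

lemma openin_prod_swap:
  assumes "openin (prod_topology Z Z) W"
  shows "openin (prod_topology Z Z) {(p, q). (q, p) \<in> W}"
proof -
  have "continuous_map (prod_topology Z Z) (prod_topology Z Z) (\<lambda>p. (snd p, fst p))"
    by (intro continuous_map_pairedI continuous_map_snd continuous_map_fst)
  from openin_continuous_map_preimage[OF this assms]
  have "openin (prod_topology Z Z) {p \<in> topspace (prod_topology Z Z). (snd p, fst p) \<in> W}" .
  moreover have "{p \<in> topspace (prod_topology Z Z). (snd p, fst p) \<in> W} = {(p, q). (q, p) \<in> W}"
    using openin_subset[OF assms] by auto
  ultimately show ?thesis by simp
qed

text \<open>Avoidance \<open>y \<notin> C\<close> of a closed set is witnessed by a basic open set that contains \<open>y\<close> and misses \<open>C\<close>.
  It therefore suffices to declare open, for each of the countably many basic sets \<open>V\<close>, the conditions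
  that \<open>V\<close> contains the point and that \<open>V\<close> misses the closed set. The indices \<open>j\<close> and \<open>k\<close> allow one
  topology to serve several points and closed sets attached to the same element of \<open>I\<close>.\<close>

lemma avoidance_topology:
  fixes x :: "'j::countable \<Rightarrow> 'i \<Rightarrow> 'a" and F :: "'j \<Rightarrow> 'i \<Rightarrow> 'a set"
  assumes M: "second_countable M"
    and x: "\<And>j p. p \<in> I \<Longrightarrow> x j p \<in> topspace M"
    and F: "\<And>j p. p \<in> I \<Longrightarrow> closedin M (F j p)"
  obtains Z where "topspace Z = I" "second_countable Z"
    "\<And>j k. openin (prod_topology Z Z) {(p, q). p \<in> I \<and> q \<in> I \<and> x j p \<notin> F k q}"
proof -
  obtain \<B> where B: "countable \<B>" "\<And>V. V \<in> \<B> \<Longrightarrow> openin M V"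
      "\<And>U y. openin M U \<Longrightarrow> y \<in> U \<Longrightarrow> \<exists>V\<in>\<B>. y \<in> V \<and> V \<subseteq> U"
    by (rule second_countable_baseE[OF M]) (rule that)
  let ?\<S> = "(\<lambda>(j, V). {p. x j p \<in> V}) ` (UNIV \<times> \<B>) \<union> (\<lambda>(j, V). {p. V \<inter> F j p = {}}) ` (UNIV \<times> \<B>)"
  have "countable ?\<S>"
    using B(1) by (intro countable_Un countable_image countable_SIGMA) auto
  then obtain Z where Z: "topspace Z = I" "second_countable Z"
      "\<And>T. T \<in> ?\<S> \<Longrightarrow> openin Z (I \<inter> T)"
    using second_countable_with_open_sets by blast
  have "openin (prod_topology Z Z) {(p, q). p \<in> I \<and> q \<in> I \<and> x j p \<notin> F k q}" for j k
    unfolding openin_prod_topology_alt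
  proof (intro allI impI)
    fix p q assume "(p, q) \<in> {(p, q). p \<in> I \<and> q \<in> I \<and> x j p \<notin> F k q}"
    then have pq: "p \<in> I" "q \<in> I" "x j p \<in> topspace M - F k q"
      using x by auto
    have "openin M (topspace M - F k q)"
      using F pq by blast
    from B(3)[OF this pq(3)] obtain V where V: "V \<in> \<B>" "x j p \<in> V" "V \<subseteq> topspace M - F k q"
      by (elim bexE conjE)
    let ?N = "I \<inter> {p. x j p \<in> V}" and ?N' = "I \<inter> {p. V \<inter> F k p = {}}"
    have "openin Z ?N" "openin Z ?N'"
      using V by (intro Z; force)+
    moreover have "p \<in> ?N" "q \<in> ?N'" "?N \<times> ?N' \<subseteq> {(p, q). p \<in> I \<and> q \<in> I \<and> x j p \<notin> F k q}"
      using pq V by auto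
    ultimately show "\<exists>U V. openin Z U \<and> openin Z V \<and> p \<in> U \<and> q \<in> V \<and>
        U \<times> V \<subseteq> {(p, q). p \<in> I \<and> q \<in> I \<and> x j p \<notin> F k q}"
      by blast
  qed
  with Z(1,2) that show ?thesis by blast
qed

section \<open>Open colorings of second countable spaces\<close>

text \<open>OCA speaks about metrizable spaces, while the topologies on index families used below need not
  separate points. Points are therefore coded by the basic sets that contain them. An open relation
  depends only on the codes, and points with equal codes are never related, since otherwise one of
  them would be related to itself; so the coloring lives on the separable metrizable set of codes.\<close>

lemma OCA_dichotomy:
  fixes Z :: "'i topology"
  assumes OCA: "OCA" and Z: "second_countable Z"
    and op: "openin (prod_topology Z Z) {(p, q). p \<in> topspace Z \<and> q \<in> topspace Z \<and> R p q}"
    and irrefl: "\<And>p. p \<in> topspace Z \<Longrightarrow> \<not> R p p"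
    and sym: "\<And>p q. R p q \<Longrightarrow> R q p"
  obtains (clique) J where "J \<subseteq> topspace Z" "uncountable J" "\<And>p q. p \<in> J \<Longrightarrow> q \<in> J \<Longrightarrow> p \<noteq> q \<Longrightarrow> R p q"
  | (cover) T :: "nat \<Rightarrow> 'i set" where "topspace Z = (\<Union>n. T n)"
      "\<And>n p q. p \<in> T n \<Longrightarrow> q \<in> T n \<Longrightarrow> \<not> R p q"
proof -
  obtain \<B> where B: "countable \<B>" "\<And>V. V \<in> \<B> \<Longrightarrow> openin Z V"
      "\<And>U y. openin Z U \<Longrightarrow> y \<in> U \<Longrightarrow> \<exists>V\<in>\<B>. y \<in> V \<and> V \<subseteq> U"
    by (rule second_countable_baseE[OF Z]) (rule that)
  define A where "A = from_nat_into (insert {} \<B>)"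
  have A: "range A = insert {} \<B>"
    using B(1) by (simp add: A_def range_from_nat_into)
  define c :: "'i \<Rightarrow> nat \<Rightarrow> real" where "c p k = (if p \<in> A k then 1 else 0)" for p k
  define S where "S = top_of_set (c ` topspace Z)"
  have topS: "topspace S = c ` topspace Z"
    by (simp add: S_def)
  have R_code: "\<exists>N N'. open N \<and> open N' \<and> c p \<in> N \<and> c q \<in> N' \<and>
      (\<forall>p'\<in>topspace Z. \<forall>q'\<in>topspace Z. c p' \<in> N \<and> c q' \<in> N' \<longrightarrow> R p' q')"
    if pq: "p \<in> topspace Z" "q \<in> topspace Z" "R p q" for p q
  proof -
    have "(p, q) \<in> {(p, q). p \<in> topspace Z \<and> q \<in> topspace Z \<and> R p q}"
      using pq by simp
    from openin_prod_rectangleE[OF op this] obtain U V where UV: "openin Z U" "openin Z V" "p \<in> U" "q \<in> V"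
        "U \<times> V \<subseteq> {(p, q). p \<in> topspace Z \<and> q \<in> topspace Z \<and> R p q}" .
    have basic: "\<exists>i. y \<in> A i \<and> A i \<subseteq> O'" if O': "openin Z O'" "y \<in> O'" for O' y
    proof -
      obtain N where N: "N \<in> \<B>" "y \<in> N" "N \<subseteq> O'"
        using B(3)[OF O'] by (elim bexE conjE)
      then have "N \<in> range A"
        by (simp add: A)
      with N show ?thesis by auto
    qed
    obtain i j where ij: "p \<in> A i" "A i \<subseteq> U" "q \<in> A j" "A j \<subseteq> V"
      using basic[OF UV(1,3)] basic[OF UV(2,4)] by (elim exE conjE)
    define N where "N k = {u :: nat \<Rightarrow> real. u k > 1/2}" for k
    have N: "open (N k)" "c p' \<in> N k \<longleftrightarrow> p' \<in> A k" for p' k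
      unfolding N_def by (rule open_coordinate_greater) (simp add: c_def)
    have "R p' q'" if "p' \<in> A i" "q' \<in> A j" for p' q'
      using that ij UV(5) by blast
    then show ?thesis
      using ij N by (intro exI[of _ "N i"] exI[of _ "N j"]) simp
  qed
  have R_cong: "R p' q'" if pq: "p \<in> topspace Z" "q \<in> topspace Z" "R p q"
    and pq': "p' \<in> topspace Z" "q' \<in> topspace Z" "c p' = c p" "c q' = c q" for p q p' q'
  proof -
    obtain N N' where "c p \<in> N" "c q \<in> N'"
        and N: "\<forall>p'\<in>topspace Z. \<forall>q'\<in>topspace Z. c p' \<in> N \<and> c q' \<in> N' \<longrightarrow> R p' q'"
      using R_code[OF pq] by (elim exE conjE)
    with pq' show ?thesis
      by simp
  qed
  have R_ne: "c p \<noteq> c q" if pq: "p \<in> topspace Z" "q \<in> topspace Z" "R p q" for p q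
  proof
    assume "c p = c q"
    then have "R p p"
      using R_cong[OF pq pq(1) pq(1)] by simp
    then show False
      using irrefl[OF pq(1)] by simp
  qed
  define K0 where "K0 = {{c p, c q} |p q. p \<in> topspace Z \<and> q \<in> topspace Z \<and> R p q}"
  have K0_iff: "{c p, c q} \<in> K0 \<longleftrightarrow> R p q" if "p \<in> topspace Z" "q \<in> topspace Z" for p q
  proof
    assume "{c p, c q} \<in> K0"
    then obtain p' q' where "p' \<in> topspace Z" "q' \<in> topspace Z" "R p' q'" "{c p, c q} = {c p', c q'}"
      unfolding K0_def by blast
    then show "R p q"
      using R_cong that sym by (metis doubleton_eq_iff)
  qed (use that in \<open>auto simp: K0_def\<close>)
  have K0_sub: "K0 \<subseteq> [topspace S]\<^bsup>2\<^esup>"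
    using R_ne by (auto simp: K0_def nsets_def topS card_2_iff)
  have "openin (prod_topology S S) {(u, v). u \<in> topspace S \<and> v \<in> topspace S \<and> u \<noteq> v \<and> {u, v} \<in> K0}"
    (is "openin _ ?O")
    unfolding openin_prod_topology_alt
  proof (intro allI impI)
    fix u v assume uv: "(u, v) \<in> ?O"
    then obtain p q where pq: "u = c p" "v = c q" "p \<in> topspace Z" "q \<in> topspace Z" "R p q"
      by (auto simp: topS K0_iff)
    from R_code[OF pq(3-5)] obtain N N' where N: "open N" "open N'" "c p \<in> N" "c q \<in> N'"
      "\<forall>p'\<in>topspace Z. \<forall>q'\<in>topspace Z. c p' \<in> N \<and> c q' \<in> N' \<longrightarrow> R p' q'" by blast
    have "openin S (c ` topspace Z \<inter> N)" "openin S (c ` topspace Z \<inter> N')"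
      using N by (auto simp: S_def openin_open)
    moreover have "(c ` topspace Z \<inter> N) \<times> (c ` topspace Z \<inter> N') \<subseteq> ?O"
      using N(5) R_ne by (auto simp: topS K0_iff)
    ultimately show "\<exists>U V. openin S U \<and> openin S V \<and> u \<in> U \<and> v \<in> V \<and> U \<times> V \<subseteq> ?O"
      using pq N(3,4)
      by (intro exI[of _ "c ` topspace Z \<inter> N"] exI[of _ "c ` topspace Z \<inter> N'"] conjI) simp_all
  qed
  moreover have "open_coloring_property S"
    unfolding S_def
    by (rule OCA_imp_open_coloring_property[OF OCA separable_metrizable_codes])
  ultimately have "(\<exists>Y\<subseteq>topspace S. uncountable Y \<and> [Y]\<^bsup>2\<^esup> \<subseteq> K0) \<or>
      (\<exists>T :: nat \<Rightarrow> _ set. topspace S = (\<Union>n. T n) \<and> (\<forall>n. [T n]\<^bsup>2\<^esup> \<subseteq> [topspace S]\<^bsup>2\<^esup> - K0))"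
    unfolding open_coloring_property_def using K0_sub
    by (elim allE[of _ K0] allE[of _ "[topspace S]\<^bsup>2\<^esup> - K0"] impE) (simp_all add: Un_absorb1)
  then consider (a) Y where "Y \<subseteq> topspace S" "uncountable Y" "[Y]\<^bsup>2\<^esup> \<subseteq> K0"
    | (b) T :: "nat \<Rightarrow> (nat \<Rightarrow> real) set" where "topspace S = (\<Union>n. T n)"
        "\<forall>n. [T n]\<^bsup>2\<^esup> \<subseteq> [topspace S]\<^bsup>2\<^esup> - K0"
    by (elim disjE exE conjE) simp_all
  then show thesis
  proof cases
    case a
    then obtain J where J: "J \<subseteq> topspace Z" "inj_on c J" "Y = c ` J"
      unfolding topS by (metis subset_image_inj)
    have "R p q" if "p \<in> J" "q \<in> J" "p \<noteq> q" for p q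
    proof -
      have "{c p, c q} \<in> [Y]\<^bsup>2\<^esup>"
        using J that by (auto simp: nsets_def inj_on_eq_iff)
      then show ?thesis
        using a(3) J(1) that K0_iff by blast
    qed
    moreover have "uncountable J"
      using a(2) J(3) by blast
    ultimately show ?thesis
      using J(1) clique by blast
  next
    case b
    show ?thesis
    proof (rule cover)
      show "topspace Z = (\<Union>n. topspace Z \<inter> c -` T n)"
        using b(1) topS by blast
      fix n p q assume pq: "p \<in> topspace Z \<inter> c -` T n" "q \<in> topspace Z \<inter> c -` T n"
      show "\<not> R p q"
      proof
        assume "R p q"
        then have "c p \<noteq> c q" "{c p, c q} \<in> K0"
          using pq R_ne K0_iff by auto
        moreover have "{c p, c q} \<in> [T n]\<^bsup>2\<^esup>"
          using pq \<open>c p \<noteq> c q\<close> by (simp add: nsets_def)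
        ultimately show False
          using b(2) by blast
      qed
    qed
  qed
qed

section \<open>Discrete subsets, networks and cosmic spaces\<close>

definition countable_discrete_subsets :: "'a topology \<Rightarrow> bool" where
  "countable_discrete_subsets X \<longleftrightarrow>
    (\<forall>D \<subseteq> topspace X. (\<forall>d\<in>D. \<exists>U. openin X U \<and> U \<inter> D = {d}) \<longrightarrow> countable D)"

lemma countable_discrete_subsetsD:
  assumes "countable_discrete_subsets X" "D \<subseteq> topspace X"
    and "\<And>d. d \<in> D \<Longrightarrow> \<exists>U. openin X U \<and> U \<inter> D = {d}"
  shows "countable D"
  using assms by (simp add: countable_discrete_subsets_def)

lemma countable_spread_iff: "spread X \<le>o natLeq \<longleftrightarrow> countable_discrete_subsets X"
proof -
  have "subtopology X D = discrete_topology D \<longleftrightarrow> (\<forall>d\<in>D. \<exists>U. openin X U \<and> U \<inter> D = {d})"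
    if "D \<subseteq> topspace X" for D
  proof -
    have "subtopology X D = discrete_topology D \<longleftrightarrow> (\<forall>d\<in>D. openin (subtopology X D) {d})"
      using that by (subst eq_commute, subst discrete_topology_unique) auto
    then show ?thesis
      by (simp add: openin_subtopology eq_commute)
  qed
  then show ?thesis
    by (auto simp: spread_le_natLeq_iff countable_discrete_subsets_def)
qed

lemma separable_metrizable_imp_second_countable:
  assumes "metrizable_space X" "separable_space X"
  shows "second_countable X"
proof -
  obtain M d where M: "Metric_space M d" and X: "X = Metric_space.mtopology M d"
    using assms(1) by (auto simp: metrizable_space_def)
  interpret Metric_space M d by (rule M)
  obtain C where C: "countable C" "C \<subseteq> M" "X closure_of C = M"
    using assms(2) X by (auto simp: separable_space_def)
  show ?thesis
    unfolding second_countable_def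
  proof (intro exI[of _ "(\<lambda>(c, n). mball c (1 / real (Suc n))) ` (C \<times> UNIV)"] conjI ballI allI impI)
    show "countable ((\<lambda>(c, n). mball c (1 / real (Suc n))) ` (C \<times> UNIV))"
      using C(1) by (intro countable_image countable_SIGMA) auto
    show "openin X V" if "V \<in> (\<lambda>(c, n). mball c (1 / real (Suc n))) ` (C \<times> UNIV)" for V
      using that by (auto simp: X)
    fix U x assume "openin X U \<and> x \<in> U"
    then obtain r where r: "r > 0" "x \<in> M" "mball x r \<subseteq> U"
      unfolding X openin_mtopology by blast
    obtain n where n: "1 / real (Suc n) < r / 2"
      using nat_approx_posE[of "r / 2"] r by auto
    have pos: "0 < 1 / real (Suc n)"
      by simp
    have "x \<in> X closure_of C"
      using C r by simp
    then obtain c where c: "c \<in> C" "c \<in> mball x (1 / real (Suc n))"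
      unfolding X metric_closure_of using pos by blast
    have "mball c (1 / real (Suc n)) \<subseteq> mball x r"
    proof
      fix y assume "y \<in> mball c (1 / real (Suc n))"
      then have "y \<in> M" "d c y < r / 2" "d x c < r / 2"
        using n c(2) by (auto simp: in_mball)
      then show "y \<in> mball x r"
        using triangle[of x c y] r(2) c(1) C(2) by (auto simp: in_mball)
    qed
    moreover have "x \<in> mball c (1 / real (Suc n))"
      using c(2) by (auto simp: in_mball commute)
    ultimately show "\<exists>V\<in>(\<lambda>(c, n). mball c (1 / real (Suc n))) ` (C \<times> UNIV). x \<in> V \<and> V \<subseteq> U"
      using c(1) r(3) by force
  qed
qed

text \<open>A discrete subset injects into a countable base of the separable metrizable preimage: a point \<open>d\<close> is
  sent to a basic set around a preimage of \<open>d\<close> whose image meets the subset only in \<open>d\<close>.\<close>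

lemma cosmic_imp_countable_discrete_subsets:
  assumes "cosmic_space X"
  shows "countable_discrete_subsets X"
  unfolding countable_discrete_subsets_def
proof (intro allI impI)
  fix D assume D: "D \<subseteq> topspace X" "\<forall>d\<in>D. \<exists>U. openin X U \<and> U \<inter> D = {d}"
  obtain Z :: "real topology" and f where Z: "metrizable_space Z" "separable_space Z"
      "continuous_map Z X f" "f ` topspace Z = topspace X"
    using assms by (auto simp: cosmic_space_def)
  then have "second_countable Z"
    using separable_metrizable_imp_second_countable by blast
  then obtain \<B> where B: "countable \<B>"
      "\<And>U y. openin Z U \<Longrightarrow> y \<in> U \<Longrightarrow> \<exists>V\<in>\<B>. y \<in> V \<and> V \<subseteq> U"
    by (rule second_countable_baseE) (rule that)
  have "\<exists>z V. V \<in> \<B> \<and> z \<in> V \<and> f z = d \<and> f ` V \<inter> D \<subseteq> {d}" if d: "d \<in> D" for d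
  proof -
    obtain U z where U: "openin X U" "U \<inter> D = {d}" "z \<in> topspace Z" "f z = d"
      using d D Z(4) by (metis imageE subsetD)
    have "openin Z {z \<in> topspace Z. f z \<in> U}"
      using Z(3) U(1) by (rule openin_continuous_map_preimage)
    from B(2)[OF this, of z] obtain V where "V \<in> \<B>" "z \<in> V" "V \<subseteq> {z \<in> topspace Z. f z \<in> U}"
      using U by auto
    then show ?thesis
      using U by (intro exI[of _ z] exI[of _ V]) auto
  qed
  then obtain z V where zV: "\<And>d. d \<in> D \<Longrightarrow> V d \<in> \<B> \<and> z d \<in> V d \<and> f (z d) = d \<and> f ` V d \<inter> D \<subseteq> {d}"
    by metis
  have "inj_on V D"
  proof (rule inj_onI)
    fix d e assume "d \<in> D" "e \<in> D" "V d = V e"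
    then have "d \<in> f ` V e \<inter> D"
      using zV[OF \<open>d \<in> D\<close>] by force
    then show "d = e"
      using zV[OF \<open>e \<in> D\<close>] by blast
  qed
  moreover have "V ` D \<subseteq> \<B>"
    using zV by blast
  ultimately show "countable D"
    using B(1) countable_image_inj_on countable_subset by blast
qed

text \<open>The sets \<open>D n\<close> form a network: they need not be open. Coding a point by the \<open>n\<close> with \<open>x \<in> D n\<close> amounts
  to making all \<open>D n\<close> clopen; the topology obtained is separable, metrizable and finer than that of \<open>X\<close>,
  so that decoding is the required continuous surjection.\<close>

lemma countable_network_imp_cosmic:
  fixes D :: "nat \<Rightarrow> 'a set"
  assumes net: "\<And>U x. openin X U \<Longrightarrow> x \<in> U \<Longrightarrow> \<exists>n. x \<in> D n \<and> D n \<subseteq> U"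
    and X: "Hausdorff_space X"
  shows "cosmic_space X"
proof -
  define c :: "'a \<Rightarrow> nat \<Rightarrow> real" where "c x n = (if x \<in> D n then 1 else 0)" for x n
  have inj: "inj_on c (topspace X)"
  proof (rule inj_onI, rule ccontr)
    fix x y assume xy: "x \<in> topspace X" "y \<in> topspace X" "c x = c y" "x \<noteq> y"
    then obtain U where "openin X U" "x \<in> U" "y \<notin> U"
      using X unfolding Hausdorff_space_def disjnt_def by blast
    then obtain n where "x \<in> D n" "y \<notin> D n"
      using net by blast
    then have "c x n \<noteq> c y n"
      by (simp add: c_def)
    with xy show False by simp
  qed
  define Z where "Z = top_of_set (c ` topspace X)"
  define g where "g = inv_into (topspace X) c"
  have g: "g (c x) = x" if "x \<in> topspace X" for x
    using inj that by (simp add: g_def)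
  show ?thesis
  proof (rule cosmic_spaceI[of Z X g])
    show "metrizable_space Z" "separable_space Z"
      by (simp_all add: Z_def separable_metrizable_codes)
    show "g ` topspace Z = topspace X"
      using g by (auto simp: Z_def image_image)
    show "continuous_map Z X g"
      unfolding continuous_map_def
    proof (intro conjI allI impI)
      show "g \<in> topspace Z \<rightarrow> topspace X"
        using g by (auto simp: Z_def)
      fix U assume U: "openin X U"
      show "openin Z {z \<in> topspace Z. g z \<in> U}"
      proof (subst openin_subopen, intro ballI)
        fix z assume "z \<in> {z \<in> topspace Z. g z \<in> U}"
        then obtain x where x: "z = c x" "x \<in> topspace X" "x \<in> U"
          using g by (auto simp: Z_def)
        then obtain n where n: "x \<in> D n" "D n \<subseteq> U"
          using net U by blast
        have "open {u :: nat \<Rightarrow> real. u n > 1/2}"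
          by (rule open_coordinate_greater)
        then have "openin Z (c ` topspace X \<inter> {u. u n > 1/2})"
          by (auto simp: Z_def openin_open)
        moreover have "z \<in> c ` topspace X \<inter> {u. u n > 1/2}"
          using x n by (auto simp: c_def)
        moreover have "c ` topspace X \<inter> {u. u n > 1/2} \<subseteq> {z \<in> topspace Z. g z \<in> U}"
          using g n by (auto simp: Z_def c_def split: if_splits)
        ultimately show "\<exists>T. openin Z T \<and> z \<in> T \<and> T \<subseteq> {z \<in> topspace Z. g z \<in> U}"
          by blast
      qed
    qed
  qed
qed

text \<open>For each \<open>e > 0\<close>, a maximal \<open>e\<close>-separated set is discrete, hence countable, and by maximality it comes
  within distance \<open>e\<close> of every point.\<close>

lemma metrizable_countable_discrete_subsets_imp_second_countable:
  assumes "metrizable_space X" "countable_discrete_subsets X"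
  shows "second_countable X"
proof -
  obtain M d where M: "Metric_space M d" and X: "X = Metric_space.mtopology M d"
    using assms(1) by (auto simp: metrizable_space_def)
  interpret Metric_space M d by (rule M)
  define sep where "sep e S \<longleftrightarrow> S \<subseteq> M \<and> (\<forall>x\<in>S. \<forall>y\<in>S. x \<noteq> y \<longrightarrow> e \<le> d x y)" for e S
  have countable_sep: "countable S" if "sep e S" "e > 0" for e S
  proof -
    have "\<exists>U. openin X U \<and> U \<inter> S = {x}" if "x \<in> S" for x
      using that \<open>sep e S\<close> \<open>e > 0\<close>
      by (intro exI[of _ "mball x e"]) (force simp: X sep_def subset_iff)
    then show ?thesis
      using assms(2) \<open>sep e S\<close> by (simp add: countable_discrete_subsets_def X sep_def)
  qed
  have "\<exists>S. sep e S \<and> (\<forall>x\<in>M. \<exists>y\<in>S. d y x < e)" if "e > 0" for e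
  proof -
    have "\<exists>S\<in>Collect (sep e). \<forall>T\<in>Collect (sep e). S \<subseteq> T \<longrightarrow> T = S"
    proof (rule subset_Zorn)
      fix \<C> assume "subset.chain (Collect (sep e)) \<C>"
      then have C: "\<And>S. S \<in> \<C> \<Longrightarrow> sep e S" "\<And>S T. S \<in> \<C> \<Longrightarrow> T \<in> \<C> \<Longrightarrow> S \<subseteq> T \<or> T \<subseteq> S"
        unfolding subset_chain_def by auto
      have "sep e (\<Union>\<C>)"
        unfolding sep_def
      proof (intro conjI ballI impI)
        fix x y assume "x \<in> \<Union>\<C>" "y \<in> \<Union>\<C>" "x \<noteq> y"
        then obtain S where "S \<in> \<C>" "x \<in> S" "y \<in> S"
          using C(2) by blast
        then show "e \<le> d x y"
          using C(1) \<open>x \<noteq> y\<close> by (auto simp: sep_def)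
      qed (use C(1) in \<open>auto simp: sep_def\<close>)
      then show "\<exists>U\<in>Collect (sep e). \<forall>S\<in>\<C>. S \<subseteq> U"
        by blast
    qed
    then obtain S where S: "sep e S" "\<And>T. sep e T \<Longrightarrow> S \<subseteq> T \<Longrightarrow> T = S"
      by blast
    have "\<exists>y\<in>S. d y x < e" if x: "x \<in> M" for x
    proof (rule ccontr)
      assume no: "\<not> (\<exists>y\<in>S. d y x < e)"
      then have "sep e (insert x S)"
        using S(1) x commute by (auto simp: sep_def not_less)
      then have "x \<in> S"
        using S(2) by blast
      then show False
        using no x \<open>e > 0\<close> by auto
    qed
    with S(1) show ?thesis by blast
  qed
  then obtain S where S: "\<And>e. e > 0 \<Longrightarrow> sep e (S e) \<and> (\<forall>x\<in>M. \<exists>y\<in>S e. d y x < e)"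
    by metis
  define C where "C = (\<Union>n. S (1 / real (Suc n)))"
  have "countable C"
    unfolding C_def
    by (intro countable_UN countableI_type countable_sep[OF conjunct1[OF S]]) simp_all
  moreover have "C \<subseteq> M"
  proof -
    have "S (1 / real (Suc n)) \<subseteq> M" for n
      using S[of "1 / real (Suc n)"] by (simp add: sep_def)
    then show ?thesis
      unfolding C_def by blast
  qed
  moreover have "X closure_of C = topspace X"
  proof (rule antisym[OF closure_of_subset_topspace], rule subsetI)
    fix x assume "x \<in> topspace X"
    then have x: "x \<in> M" by (simp add: X)
    have "\<exists>y\<in>C. y \<in> mball x r" if "r > 0" for r
    proof -
      obtain n where n: "1 / real (Suc n) < r"
        using nat_approx_posE[OF \<open>r > 0\<close>] by auto
      obtain y where "y \<in> S (1 / real (Suc n))" "d y x < 1 / real (Suc n)"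
        using S[of "1 / real (Suc n)"] x by auto
      then show ?thesis
        using n x \<open>C \<subseteq> M\<close> commute[of x y] by (intro bexI[of _ y]) (auto simp: C_def in_mball)
    qed
    then show "x \<in> X closure_of C"
      using x by (auto simp: X metric_closure_of)
  qed
  ultimately have "separable_space X"
    unfolding separable_space_def by (metis X topspace_mtopology)
  then show ?thesis
    using assms(1) separable_metrizable_imp_second_countable by blast
qed

section \<open>Consequences of OCA for families of closed neighbourhoods\<close>

text \<open>If for every two members of an uncountable subfamily both points avoided the neighbourhood of the
  other one, the points would form an uncountable discrete set. So the other alternative of OCA
  holds, and one of its countably many pieces is uncountable.\<close>

lemma uncountable_comparable_subfamily:
  assumes OCA: "OCA" and M: "second_countable M" "topspace M = topspace X"
    and X: "countable_discrete_subsets X"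
    and I: "uncountable I"
    and F: "\<And>p. p \<in> I \<Longrightarrow> closedin M (F p)"
    and U: "\<And>p. p \<in> I \<Longrightarrow> openin X (U p) \<and> x p \<in> U p \<and> U p \<subseteq> F p"
  obtains J where "J \<subseteq> I" "uncountable J" "\<And>p q. p \<in> J \<Longrightarrow> q \<in> J \<Longrightarrow> x q \<in> F p \<or> x p \<in> F q"
proof -
  have x: "x p \<in> topspace X" if "p \<in> I" for p
    using U[OF that] openin_subset by blast
  obtain Z where Z: "topspace Z = I" "second_countable Z"
      "\<And>j k :: unit. openin (prod_topology Z Z) {(p, q). p \<in> I \<and> q \<in> I \<and> x p \<notin> F q}"
    by (rule avoidance_topology[of M I "\<lambda>_. x" "\<lambda>_. F", OF M(1)])
      (simp add: x M(2), simp add: F, rule that)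
  define R where "R p q \<longleftrightarrow> x p \<notin> F q \<and> x q \<notin> F p" for p q
  have "openin (prod_topology Z Z) ({(p, q). p \<in> I \<and> q \<in> I \<and> x p \<notin> F q} \<inter>
      {(p, q). (q, p) \<in> {(p, q). p \<in> I \<and> q \<in> I \<and> x p \<notin> F q}})"
    by (intro openin_Int openin_prod_swap Z(3))
  also have "\<dots> = {(p, q). p \<in> topspace Z \<and> q \<in> topspace Z \<and> R p q}"
    by (auto simp: R_def Z(1))
  finally have op: "openin (prod_topology Z Z) {(p, q). p \<in> topspace Z \<and> q \<in> topspace Z \<and> R p q}" .
  show thesis
  proof (rule OCA_dichotomy[OF OCA Z(2) op])
    show "\<not> R p p" if "p \<in> topspace Z" for p
      using that U Z(1) by (auto simp: R_def)
    show "R q p" if "R p q" for p q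
      using that by (auto simp: R_def)
  next
    fix J assume J: "J \<subseteq> topspace Z" "uncountable J"
      "\<And>p q. p \<in> J \<Longrightarrow> q \<in> J \<Longrightarrow> p \<noteq> q \<Longrightarrow> R p q"
    have JI: "J \<subseteq> I"
      using J(1) Z(1) by simp
    have avoid: "x q \<notin> U p" if "p \<in> J" "q \<in> J" "p \<noteq> q" for p q
      using J(3)[OF that] U JI that by (auto simp: R_def)
    have "countable (x ` J)"
    proof (rule countable_discrete_subsetsD[OF X])
      show "x ` J \<subseteq> topspace X"
        using x JI by blast
      fix d assume "d \<in> x ` J"
      then obtain p where p: "p \<in> J" "d = x p"
        by blast
      have "U p \<inter> x ` J = {d}"
        using p avoid[OF p(1)] U[of p] JI by auto
      then show "\<exists>W. openin X W \<and> W \<inter> x ` J = {d}"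
        using U[of p] p JI by blast
    qed
    moreover have "inj_on x J"
    proof (rule inj_onI, rule ccontr)
      fix p q assume "p \<in> J" "q \<in> J" "x p = x q" "p \<noteq> q"
      then show False
        using avoid[of p q] U[of p] JI by auto
    qed
    ultimately show thesis
      using J(2) countable_image_inj_on by blast
  next
    fix T :: "nat \<Rightarrow> 'b set"
    assume T: "topspace Z = (\<Union>n. T n)" "\<And>n p q. p \<in> T n \<Longrightarrow> q \<in> T n \<Longrightarrow> \<not> R p q"
    have "\<exists>n. uncountable (T n)"
      using I countable_UN[of UNIV T] unfolding Z(1)[symmetric] T(1) by auto
    then obtain n where n: "uncountable (T n)"
      by (rule exE)
    show thesis
    proof (rule that[of "T n"])
      show "T n \<subseteq> I"
        using T(1) Z(1) by auto
      show "x q \<in> F p \<or> x p \<in> F q" if "p \<in> T n" "q \<in> T n" for p q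
        using T(2)[OF that] by (auto simp: R_def)
    qed (rule n)
  qed
qed

text \<open>Read \<open>y \<notin> F z\<close> as \<open>y < z\<close>; this relation need not be transitive. The conclusion says that the
  relation \<open>E\<close> is strictly decreasing. If OCA gave a countable cover of \<open>Y \<times> Y\<close> by pieces without
  strictly decreasing pairs, then over each \<open>a\<close> some piece would contain two points \<open>(a, y)\<close> and
  \<open>(a, z)\<close> with \<open>y < z\<close>, and \<open>y\<close>, \<open>z\<close> would have basic neighbourhoods \<open>N\<close>, \<open>N'\<close> with \<open>N < N'\<close>.
  Two different points \<open>c < c'\<close> of \<open>Y\<close> would share the piece and both neighbourhoods. Then the upper
  point over \<open>c\<close> and the lower point over \<open>c'\<close> would be strictly decreasing within one piece.\<close>

lemma uncountable_reversing_pairs: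
  assumes OCA: "OCA" and M: "second_countable M"
    and Y: "Y \<subseteq> topspace M" "uncountable Y"
    and F: "\<And>y. y \<in> Y \<Longrightarrow> closedin M (F y)" "\<And>y. y \<in> Y \<Longrightarrow> y \<in> F y"
    and sep: "\<And>y z. y \<in> Y \<Longrightarrow> z \<in> Y \<Longrightarrow> y \<noteq> z \<Longrightarrow> y \<notin> F z \<or> z \<notin> F y"
  obtains E where "E \<subseteq> Y \<times> Y" "uncountable E"
    "\<And>a b a' b'. (a, b) \<in> E \<Longrightarrow> (a', b') \<in> E \<Longrightarrow> (a, b) \<noteq> (a', b') \<Longrightarrow>
        (a \<notin> F a' \<and> b' \<notin> F b) \<or> (a' \<notin> F a \<and> b \<notin> F b')"
proof -
  define x :: "bool \<Rightarrow> 'a \<times> 'a \<Rightarrow> 'a" where "x j p = (if j then fst p else snd p)" for j p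
  obtain Z where Z: "topspace Z = Y \<times> Y" "second_countable Z"
      "\<And>j k. openin (prod_topology Z Z) {(p, q). p \<in> Y \<times> Y \<and> q \<in> Y \<times> Y \<and> x j p \<notin> F (x k q)}"
  proof (rule avoidance_topology[of M "Y \<times> Y" x "\<lambda>k q. F (x k q)", OF M])
    show "x j p \<in> topspace M" if "p \<in> Y \<times> Y" for j p
      using that Y(1) by (auto simp: x_def)
    show "closedin M (F (x j p))" if "p \<in> Y \<times> Y" for j p
      using that F(1) by (auto simp: x_def)
  qed (rule that)
  define R where "R p q \<longleftrightarrow> (fst p \<notin> F (fst q) \<and> snd q \<notin> F (snd p)) \<or>
      (fst q \<notin> F (fst p) \<and> snd p \<notin> F (snd q))" for p q
  let ?A = "\<lambda>j. {(p, q). p \<in> Y \<times> Y \<and> q \<in> Y \<times> Y \<and> x j p \<notin> F (x j q)}"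
  let ?B = "\<lambda>j. {(p, q). (q, p) \<in> ?A j}"
  have "openin (prod_topology Z Z) (?A True \<inter> ?B False \<union> ?B True \<inter> ?A False)"
    by (intro openin_Un openin_Int openin_prod_swap Z(3))
  also have "?A True \<inter> ?B False \<union> ?B True \<inter> ?A False =
      {(p, q). p \<in> topspace Z \<and> q \<in> topspace Z \<and> R p q}"
    by (auto simp: R_def Z(1) x_def)
  finally have op: "openin (prod_topology Z Z) {(p, q). p \<in> topspace Z \<and> q \<in> topspace Z \<and> R p q}" .
  show thesis
  proof (rule OCA_dichotomy[OF OCA Z(2) op])
    show "\<not> R p p" if "p \<in> topspace Z" for p
      using that F(2) Z(1) by (auto simp: R_def)
    show "R q p" if "R p q" for p q
      using that by (auto simp: R_def)
  next
    fix J assume J: "J \<subseteq> topspace Z" "uncountable J"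
      "\<And>p q. p \<in> J \<Longrightarrow> q \<in> J \<Longrightarrow> p \<noteq> q \<Longrightarrow> R p q"
    show thesis
    proof (rule that[of J])
      show "J \<subseteq> Y \<times> Y" "uncountable J"
        using J Z(1) by auto
      fix a b a' b' assume "(a, b) \<in> J" "(a', b') \<in> J" "(a, b) \<noteq> (a', b')"
      from J(3)[OF this] show "(a \<notin> F a' \<and> b' \<notin> F b) \<or> (a' \<notin> F a \<and> b \<notin> F b')"
        by (simp add: R_def)
    qed
  next
    fix T :: "nat \<Rightarrow> ('a \<times> 'a) set"
    assume T: "topspace Z = (\<Union>n. T n)" "\<And>n p q. p \<in> T n \<Longrightarrow> q \<in> T n \<Longrightarrow> \<not> R p q"
    obtain W where W: "topspace W = Y" "second_countable W"
        "\<And>j k :: unit. openin (prod_topology W W) {(y, z). y \<in> Y \<and> z \<in> Y \<and> y \<notin> F z}"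
      by (rule avoidance_topology[of M Y "\<lambda>_ y. y" "\<lambda>_. F", OF M])
        (use Y(1) in blast, simp add: F(1), rule that)
    obtain \<B> where B: "countable \<B>"
        "\<And>U y. openin W U \<Longrightarrow> y \<in> U \<Longrightarrow> \<exists>V\<in>\<B>. y \<in> V \<and> V \<subseteq> U"
      using W(2) by (rule second_countable_baseE) (rule that)
    have "\<exists>n y z N N'. (a, y) \<in> T n \<and> (a, z) \<in> T n \<and> y \<in> N \<and> z \<in> N' \<and> N \<in> \<B> \<and> N' \<in> \<B> \<and>
        (\<forall>y'\<in>N. \<forall>z'\<in>N'. y' \<notin> F z')" if a: "a \<in> Y" for a
    proof -
      have "\<exists>n. (a, y) \<in> T n" if "y \<in> Y" for y
        using T(1) Z(1) a that by blast
      then obtain g where g: "\<And>y. y \<in> Y \<Longrightarrow> (a, y) \<in> T (g y)"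
        by metis
      obtain n where "uncountable {y \<in> Y. g y = n}"
        using uncountable_fiber[OF Y(2), of "UNIV :: nat set" g] by auto
      then obtain y z where yz: "y \<in> Y" "g y = n" "z \<in> Y" "g z = n" "y \<noteq> z"
        by (rule uncountable_two_points) auto
      have "(a, y) \<in> T n" "(a, z) \<in> T n"
        using g[of y] g[of z] yz by simp_all
      then obtain u v where uv: "u \<in> Y" "v \<in> Y" "(a, u) \<in> T n" "(a, v) \<in> T n" "u \<notin> F v"
        using sep[OF yz(1,3,5)] yz(1,3) by (elim disjE) simp_all
      then have "(u, v) \<in> {(y, z). y \<in> Y \<and> z \<in> Y \<and> y \<notin> F z}"
        by simp
      from openin_prod_rectangleE[OF W(3) this] obtain U V where UV: "openin W U" "openin W V" "u \<in> U" "v \<in> V"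
          "U \<times> V \<subseteq> {(y, z). y \<in> Y \<and> z \<in> Y \<and> y \<notin> F z}" .
      obtain N where N: "N \<in> \<B>" "u \<in> N" "N \<subseteq> U"
        using B(2)[OF UV(1,3)] by (elim bexE conjE)
      obtain N' where N': "N' \<in> \<B>" "v \<in> N'" "N' \<subseteq> V"
        using B(2)[OF UV(2,4)] by (elim bexE conjE)
      have "\<forall>y'\<in>N. \<forall>z'\<in>N'. y' \<notin> F z'"
        using UV(5) N(3) N'(3) by blast
      then show ?thesis
        using uv(3,4) N(1,2) N'(1,2) by (intro exI conjI)
    qed
    then obtain n y z N N' where
      pieces: "\<And>a. a \<in> Y \<Longrightarrow> (a, y a) \<in> T (n a) \<and> (a, z a) \<in> T (n a) \<and> y a \<in> N a \<and> z a \<in> N' a \<and>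
        N a \<in> \<B> \<and> N' a \<in> \<B> \<and> (\<forall>y'\<in>N a. \<forall>z'\<in>N' a. y' \<notin> F z')"
      by metis
    define g where "g a = (n a, N a, N' a)" for a
    have "countable ((UNIV :: nat set) \<times> \<B> \<times> \<B>)"
      using B(1) by (intro countable_SIGMA) auto
    moreover have "g a \<in> UNIV \<times> \<B> \<times> \<B>" if "a \<in> Y" for a
      using pieces[OF that] by (simp add: g_def)
    ultimately obtain k where "uncountable {a \<in> Y. g a = k}"
      by (rule uncountable_fiber[OF Y(2)])
    then obtain a a' where "a \<in> Y" "a' \<in> Y" "g a = g a'" "a \<noteq> a'"
      by (rule uncountable_two_points) auto
    then obtain c c' where c: "c \<in> Y" "c' \<in> Y" "g c = g c'" "c \<notin> F c'"
      using sep[of a a'] by force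
    have same: "n c' = n c" "N c' = N c" "N' c' = N' c"
      using c(3) by (simp_all add: g_def)
    have "y c' \<in> N c" "z c \<in> N' c" "\<forall>y'\<in>N c. \<forall>z'\<in>N' c. y' \<notin> F z'"
      using pieces[OF c(1)] pieces[OF c(2)] same by simp_all
    then have "y c' \<notin> F (z c)"
      by blast
    then have "R (c, z c) (c', y c')"
      using c(4) by (simp add: R_def)
    moreover have "(c, z c) \<in> T (n c)" "(c', y c') \<in> T (n c)"
      using pieces[OF c(1)] pieces[OF c(2)] same by auto
    ultimately show thesis
      using T(2)[of "(c, z c)" "n c" "(c', y c')"] by simp
  qed
qed

section \<open>Cometrizable groups\<close>

text \<open>The discrete set consists of the sums \<open>a + b\<close> over pairs \<open>(a, b)\<close> in a strictly decreasing relation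
  \<open>E2\<close>. For pairs \<open>(a, b)\<close> and \<open>(a', b')\<close>, exactly one of \<open>a'\<close>, \<open>b'\<close> leaves its neighbourhood \<open>F a\<close>,
  \<open>F b\<close>, while the other one stays in a neighbourhood \<open>C a b\<close> or \<open>D a b\<close> that was chosen much smaller.
  If \<open>a' + b' = a + v + b\<close> with \<open>v\<close> small and \<open>a' = a + w\<close> with \<open>w\<close> small, then \<open>b' = - w + v + b\<close> is close to
  \<open>b\<close>, a contradiction; symmetrically for \<open>b' = w + b\<close>. The sets \<open>V a b\<close> give the meaning of small, and must
  depend on both coordinates, because smallness in one is transferred to the other.\<close>

lemma weakly_separated_imp_countable:
  fixes M :: "'g::topological_group_add topology"
  assumes OCA: "OCA" and M: "second_countable M" "topspace M = UNIV"
    and base: "neighbourhood_base_of (closedin M) euclidean"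
    and spread: "countable_discrete_subsets (euclidean :: 'g topology)"
    and F: "\<And>y. y \<in> Y \<Longrightarrow> closedin M (F y)"
    and U: "\<And>y. y \<in> Y \<Longrightarrow> open (U y) \<and> y \<in> U y \<and> U y \<subseteq> F y"
    and sep: "\<And>y z. y \<in> Y \<Longrightarrow> z \<in> Y \<Longrightarrow> y \<noteq> z \<Longrightarrow> y \<notin> F z \<or> z \<notin> F y"
  shows "countable Y"
proof (rule ccontr)
  assume Y: "uncountable Y"
  obtain E where E: "E \<subseteq> Y \<times> Y" "uncountable E"
    "\<And>a b a' b'. (a, b) \<in> E \<Longrightarrow> (a', b') \<in> E \<Longrightarrow> (a, b) \<noteq> (a', b') \<Longrightarrow>
        (a \<notin> F a' \<and> b' \<notin> F b) \<or> (a' \<notin> F a \<and> b \<notin> F b')"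
  proof (rule uncountable_reversing_pairs[OF OCA M(1) _ Y, of F])
    show "y \<in> F y" if "y \<in> Y" for y
      using U[OF that] by blast
    show "Y \<subseteq> topspace M"
      using M(2) by simp
  qed (erule F, erule (2) sep, rule that)
  have closed_nhd: "\<exists>U C. open U \<and> closedin M C \<and> x \<in> U \<and> U \<subseteq> C \<and> C \<subseteq> W"
    if "open W" "x \<in> W" for x W
    using base that unfolding neighbourhood_base_of open_openin[symmetric] by blast
  have "\<exists>V. open V \<and> 0 \<in> V \<and> (\<forall>v\<in>V. \<forall>w\<in>V. a + v - w \<in> U a \<and> - w + v + b \<in> U b)"
    if ab: "a \<in> Y" "b \<in> Y" for a b
  proof -
    let ?F = "nhds (0 :: 'g) \<times>\<^sub>F nhds (0 :: 'g)"
    have lim: "(fst \<longlongrightarrow> (0 :: 'g)) ?F" "(snd \<longlongrightarrow> (0 :: 'g)) ?F"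
      by (rule filterlim_fst, rule filterlim_snd)
    have "((\<lambda>p. a + fst p - snd p) \<longlongrightarrow> a + 0 - 0) ?F"
      by (intro tendsto_add tendsto_diff tendsto_const lim)
    then have "\<forall>\<^sub>F p in ?F. a + fst p - snd p \<in> U a"
      by (rule topological_tendstoD) (use U[OF ab(1)] in auto)
    moreover have "((\<lambda>p. - snd p + fst p + b) \<longlongrightarrow> - 0 + 0 + b) ?F"
      by (intro tendsto_add tendsto_minus tendsto_const lim)
    then have "\<forall>\<^sub>F p in ?F. - snd p + fst p + b \<in> U b"
      by (rule topological_tendstoD) (use U[OF ab(2)] in auto)
    ultimately have "\<forall>\<^sub>F p in ?F. a + fst p - snd p \<in> U a \<and> - snd p + fst p + b \<in> U b"
      by (rule eventually_conj)
    then obtain P Q where PQ: "eventually P (nhds (0::'g))" "eventually Q (nhds (0::'g))"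
        "\<And>v w. P v \<Longrightarrow> Q w \<Longrightarrow> a + v - w \<in> U a \<and> - w + v + b \<in> U b"
      unfolding eventually_prod_filter by auto
    from eventually_conj[OF PQ(1,2)] obtain V where "open V" "0 \<in> V" "\<forall>v\<in>V. P v \<and> Q v"
      unfolding eventually_nhds by blast
    then show ?thesis
      by (intro exI[of _ V]) (simp add: PQ(3))
  qed
  then obtain V where V: "\<And>a b. a \<in> Y \<Longrightarrow> b \<in> Y \<Longrightarrow> open (V a b) \<and> 0 \<in> V a b \<and>
      (\<forall>v\<in>V a b. \<forall>w\<in>V a b. a + v - w \<in> U a \<and> - w + v + b \<in> U b)"
    by metis
  have cont: "continuous_on UNIV (\<lambda>z :: 'g. a + z)" "continuous_on UNIV (\<lambda>z :: 'g. z - a)" for a :: 'g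
    by (intro continuous_intros)+
  have left: "\<exists>O1 C. open O1 \<and> closedin M C \<and> a \<in> O1 \<and> O1 \<subseteq> C \<and> (\<forall>z\<in>C. - a + z \<in> V a b)"
    if "a \<in> Y" "b \<in> Y" for a b
  proof -
    have op: "open ((\<lambda>z. - a + z) -` V a b)"
      using V[OF that] cont(1) by (intro open_vimage) auto
    have mem: "a \<in> (\<lambda>z. - a + z) -` V a b"
      using V[OF that] by simp
    obtain O' C where "open O'" "closedin M C" "a \<in> O'" "O' \<subseteq> C" "C \<subseteq> (\<lambda>z. - a + z) -` V a b"
      using closed_nhd[OF op mem] by (elim exE conjE)
    then show ?thesis
      by (intro exI[of _ O'] exI[of _ C]) auto
  qed
  have right: "\<exists>O1 C. open O1 \<and> closedin M C \<and> b \<in> O1 \<and> O1 \<subseteq> C \<and> (\<forall>z\<in>C. z - b \<in> V a b)"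
    if "a \<in> Y" "b \<in> Y" for a b
  proof -
    have op: "open ((\<lambda>z. z - b) -` V a b)"
      using V[OF that] cont(2) by (intro open_vimage) auto
    have mem: "b \<in> (\<lambda>z. z - b) -` V a b"
      using V[OF that] by simp
    obtain O' C where "open O'" "closedin M C" "b \<in> O'" "O' \<subseteq> C" "C \<subseteq> (\<lambda>z. z - b) -` V a b"
      using closed_nhd[OF op mem] by (elim exE conjE)
    then show ?thesis
      by (intro exI[of _ O'] exI[of _ C]) auto
  qed
  obtain O1 C where C: "\<And>a b. a \<in> Y \<Longrightarrow> b \<in> Y \<Longrightarrow> open (O1 a b) \<and> closedin M (C a b) \<and> a \<in> O1 a b \<and>
      O1 a b \<subseteq> C a b \<and> (\<forall>z\<in>C a b. - a + z \<in> V a b)"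
    using left by metis
  obtain O2 D where D: "\<And>a b. a \<in> Y \<Longrightarrow> b \<in> Y \<Longrightarrow> open (O2 a b) \<and> closedin M (D a b) \<and> b \<in> O2 a b \<and>
      O2 a b \<subseteq> D a b \<and> (\<forall>z\<in>D a b. z - b \<in> V a b)"
    using right by metis
  have top: "topspace M = topspace (euclidean :: 'g topology)"
    using M(2) by simp
  \<comment> \<open>If \<open>a \<notin> F a'\<close> then \<open>a \<notin> C a' b'\<close>, so that comparability forces \<open>a' \<in> C a b\<close>.\<close>
  obtain E1 where E1: "E1 \<subseteq> E" "uncountable E1"
      "\<And>p q. p \<in> E1 \<Longrightarrow> q \<in> E1 \<Longrightarrow> fst q \<in> C (fst p) (snd p) \<or> fst p \<in> C (fst q) (snd q)"
  proof (rule uncountable_comparable_subfamily[OF OCA M(1) top spread E(2),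
        of "\<lambda>p. C (fst p) (snd p)" "\<lambda>p. O1 (fst p) (snd p)" fst])
    fix p assume "p \<in> E"
    then have "fst p \<in> Y" "snd p \<in> Y"
      using E(1) by auto
    from C[OF this] show "closedin M (C (fst p) (snd p))"
      "openin euclidean (O1 (fst p) (snd p)) \<and> fst p \<in> O1 (fst p) (snd p) \<and>
        O1 (fst p) (snd p) \<subseteq> C (fst p) (snd p)"
      by auto
  qed (rule that)
  obtain E2 where E2: "E2 \<subseteq> E1" "uncountable E2"
      "\<And>p q. p \<in> E2 \<Longrightarrow> q \<in> E2 \<Longrightarrow> snd q \<in> D (fst p) (snd p) \<or> snd p \<in> D (fst q) (snd q)"
  proof (rule uncountable_comparable_subfamily[OF OCA M(1) top spread E1(2),
        of "\<lambda>p. D (fst p) (snd p)" "\<lambda>p. O2 (fst p) (snd p)" snd])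
    fix p assume "p \<in> E1"
    then have "fst p \<in> Y" "snd p \<in> Y"
      using E(1) E1(1) by auto
    from D[OF this] show "closedin M (D (fst p) (snd p))"
      "openin euclidean (O2 (fst p) (snd p)) \<and> snd p \<in> O2 (fst p) (snd p) \<and>
        O2 (fst p) (snd p) \<subseteq> D (fst p) (snd p)"
      by auto
  qed (rule that)
  have isolated: "- a + (a' + b') - b \<notin> V a b"
    if ab: "(a, b) \<in> E2" and ab': "(a', b') \<in> E2" and ne: "(a, b) \<noteq> (a', b')" for a b a' b'
  proof
    assume v: "- a + (a' + b') - b \<in> V a b"
    have Y4: "a \<in> Y" "b \<in> Y" "a' \<in> Y" "b' \<in> Y"
      using ab ab' E(1) E1(1) E2(1) by auto
    have "(a \<notin> F a' \<and> b' \<notin> F b) \<or> (a' \<notin> F a \<and> b \<notin> F b')"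
      using ab ab' ne E1(1) E2(1) by (intro E(3)) auto
    then show False
    proof (elim disjE conjE)
      assume out: "a \<notin> F a'" "b' \<notin> F b"
      have "a \<notin> C a' b'"
      proof
        assume "a \<in> C a' b'"
        then have "a' + (- a' + a) - 0 \<in> U a'"
          using C[OF Y4(3,4)] V[OF Y4(3,4)] by blast
        then show False
          using U[OF Y4(3)] out(1) by (auto simp: add.assoc[symmetric])
      qed
      then have "a' \<in> C a b"
        using E1(3)[of "(a, b)" "(a', b')"] ab ab' E2(1) by auto
      then have "- (- a + a') + (- a + (a' + b') - b) + b \<in> U b"
        using C[OF Y4(1,2)] V[OF Y4(1,2)] v by blast
      also have "- (- a + a') + (- a + (a' + b') - b) + b = b'"
        by (simp add: minus_add add.assoc diff_conv_add_uminus del: add_uminus_conv_diff)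
      finally show False
        using U[OF Y4(2)] out(2) by blast
    next
      assume out: "a' \<notin> F a" "b \<notin> F b'"
      have "b \<notin> D a' b'"
      proof
        assume "b \<in> D a' b'"
        then have "- 0 + (b - b') + b' \<in> U b'"
          using D[OF Y4(3,4)] V[OF Y4(3,4)] by blast
        then show False
          using U[OF Y4(4)] out(2) by auto
      qed
      then have "b' \<in> D a b"
        using E2(3)[of "(a, b)" "(a', b')"] ab ab' by auto
      then have "a + (- a + (a' + b') - b) - (b' - b) \<in> U a"
        using D[OF Y4(1,2)] V[OF Y4(1,2)] v by blast
      also have "a + (- a + (a' + b') - b) - (b' - b) = a'"
        by (simp add: minus_add add.assoc diff_conv_add_uminus del: add_uminus_conv_diff)
      finally show False
        using U[OF Y4(1)] out(1) by blast
    qed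
  qed
  define s where "s p = fst p + snd p" for p :: "'g \<times> 'g"
  define W where "W a b = {z. - a + z - b \<in> V a b}" for a b
  have W: "open (W a b) \<and> a + b \<in> W a b" if "a \<in> Y" "b \<in> Y" for a b
  proof
    have "open ((\<lambda>z. - a + z - b) -` V a b)"
      using V[OF that] by (intro open_vimage continuous_intros) auto
    then show "open (W a b)"
      by (simp add: W_def vimage_def)
    show "a + b \<in> W a b"
      using V[OF that] by (simp add: W_def add.assoc[symmetric])
  qed
  have isolated_sum: "s q \<notin> W (fst p) (snd p)" if "p \<in> E2" "q \<in> E2" "p \<noteq> q" for p q
    using isolated[of "fst p" "snd p" "fst q" "snd q"] that by (simp add: s_def W_def)
  have EY: "fst p \<in> Y" "snd p \<in> Y" if "p \<in> E2" for p
  proof -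
    have "p \<in> Y \<times> Y"
      using that E(1) E1(1) E2(1) by blast
    then show "fst p \<in> Y" "snd p \<in> Y"
      by auto
  qed
  have "countable (s ` E2)"
  proof (rule countable_discrete_subsetsD[OF spread])
    fix d assume "d \<in> s ` E2"
    then obtain p where p: "p \<in> E2" "d = s p"
      by blast
    have "W (fst p) (snd p) \<inter> s ` E2 = {d}"
      using p isolated_sum[OF p(1)] W[OF EY[OF p(1)]] by (auto simp: s_def)
    then show "\<exists>O'. openin euclidean O' \<and> O' \<inter> s ` E2 = {d}"
      using W[OF EY[OF p(1)]] by auto
  qed simp
  moreover have "inj_on s E2"
  proof (rule inj_onI, rule ccontr)
    fix p q assume "p \<in> E2" "q \<in> E2" "s p = s q" "p \<noteq> q"
    then show False
      using isolated_sum[of p q] W[OF EY[of p]] by (simp add: s_def)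
  qed
  ultimately show False
    using E2(2) countable_image_inj_on by blast
qed

theorem corollary4:
  assumes "OCA"
    and "cometrizable_space (euclidean :: 'g::topological_group_add topology)"
  shows "cosmic_space (euclidean :: 'g topology) \<longleftrightarrow> spread (euclidean :: 'g topology) \<le>o natLeq"
proof
  assume "cosmic_space (euclidean :: 'g topology)"
  then show "spread (euclidean :: 'g topology) \<le>o natLeq"
    using countable_spread_iff cosmic_imp_countable_discrete_subsets by blast
next
  assume "spread (euclidean :: 'g topology) \<le>o natLeq"
  then have spread: "countable_discrete_subsets (euclidean :: 'g topology)"
    by (simp add: countable_spread_iff)
  obtain M :: "'g topology" where M: "metrizable_space M" "topspace M = UNIV"
      "\<And>U. openin M U \<Longrightarrow> open U" "neighbourhood_base_of (closedin M) euclidean"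
    using assms(2) by (auto simp: cometrizable_space_def)
  have "countable_discrete_subsets M"
    unfolding countable_discrete_subsets_def
  proof (intro allI impI)
    fix D :: "'g set" assume D: "\<forall>d\<in>D. \<exists>U. openin M U \<and> U \<inter> D = {d}"
    show "countable D"
    proof (rule countable_discrete_subsetsD[OF spread])
      fix d assume "d \<in> D"
      then obtain U where "openin M U" "U \<inter> D = {d}"
        using D by blast
      then show "\<exists>U. openin euclidean U \<and> U \<inter> D = {d}"
        using M(3)[of U] by auto
    qed simp
  qed
  then have M2: "second_countable M"
    by (rule metrizable_countable_discrete_subsets_imp_second_countable[OF M(1)])
  have closed_nhd: "\<exists>U C. open U \<and> closedin M C \<and> x \<in> U \<and> U \<subseteq> C \<and> C \<subseteq> W"
    if "open W" "x \<in> W" for x :: 'g and W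
    using M(4) that unfolding neighbourhood_base_of open_openin[symmetric] by blast
  \<comment> \<open>A point occurs in \<open>I\<close> with all its \<open>M\<close>-closed neighbourhoods, so that a countable decomposition of
    \<open>I\<close> sees arbitrarily small ones.\<close>
  define I where "I = {(x, C). closedin M C \<and> (\<exists>U. open U \<and> x \<in> U \<and> U \<subseteq> C)}"
  obtain Z where Z: "topspace Z = I" "second_countable Z"
      "\<And>j k :: unit. openin (prod_topology Z Z) {(p, q). p \<in> I \<and> q \<in> I \<and> fst p \<notin> snd q}"
    by (rule avoidance_topology[of M I "\<lambda>_. fst" "\<lambda>_. snd", OF M2])
      (simp add: M(2), force simp: I_def, rule that)
  define R :: "'g \<times> 'g set \<Rightarrow> 'g \<times> 'g set \<Rightarrow> bool"
    where "R p q \<longleftrightarrow> fst p \<notin> snd q \<or> fst q \<notin> snd p" for p q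
  have "openin (prod_topology Z Z) ({(p, q). p \<in> I \<and> q \<in> I \<and> fst p \<notin> snd q} \<union>
      {(p, q). (q, p) \<in> {(p, q). p \<in> I \<and> q \<in> I \<and> fst p \<notin> snd q}})"
    by (intro openin_Un openin_prod_swap Z(3))
  also have "\<dots> = {(p, q). p \<in> topspace Z \<and> q \<in> topspace Z \<and> R p q}"
    by (auto simp: R_def Z(1))
  finally have op: "openin (prod_topology Z Z) {(p, q). p \<in> topspace Z \<and> q \<in> topspace Z \<and> R p q}" .
  show "cosmic_space (euclidean :: 'g topology)"
  proof (rule OCA_dichotomy[OF assms(1) Z(2) op])
    show "\<not> R p p" if "p \<in> topspace Z" for p
      using that Z(1) by (auto simp: R_def I_def)
    show "R q p" if "R p q" for p q
      using that by (auto simp: R_def)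
  next
    fix J assume J: "J \<subseteq> topspace Z" "uncountable J"
      "\<And>p q. p \<in> J \<Longrightarrow> q \<in> J \<Longrightarrow> p \<noteq> q \<Longrightarrow> R p q"
    have JI: "closedin M (snd p) \<and> (\<exists>U. open U \<and> fst p \<in> U \<and> U \<subseteq> snd p)" if "p \<in> J" for p
    proof -
      have "p \<in> I"
        using that J(1) Z(1) by auto
      then show ?thesis
        by (cases p) (simp add: I_def)
    qed
    then obtain U where U: "\<And>p. p \<in> J \<Longrightarrow> open (U p) \<and> fst p \<in> U p \<and> U p \<subseteq> snd p"
      by metis
    \<comment> \<open>A point lies in all of its own neighbourhoods, so no point occurs twice in \<open>J\<close>, and each point
      of \<open>fst ` J\<close> carries a single neighbourhood.\<close>
    have inj: "inj_on fst J"
    proof (rule inj_onI, rule ccontr)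
      fix p q assume "p \<in> J" "q \<in> J" "fst p = fst q" "p \<noteq> q"
      then show False
        using J(3)[of p q] U[of p] U[of q] by (auto simp: R_def)
    qed
    define h where "h = inv_into J fst"
    have h: "h y \<in> J" "fst (h y) = y" if "y \<in> fst ` J" for y
      using that by (auto simp: h_def inv_into_into f_inv_into_f)
    have "countable (fst ` J)"
    proof (rule weakly_separated_imp_countable[OF assms(1) M2 M(2,4) spread,
          of "fst ` J" "\<lambda>y. snd (h y)" "\<lambda>y. U (h y)"])
      fix y assume y: "y \<in> fst ` J"
      show "closedin M (snd (h y))"
        using JI h(1)[OF y] by blast
      show "open (U (h y)) \<and> y \<in> U (h y) \<and> U (h y) \<subseteq> snd (h y)"
        using U[OF h(1)[OF y]] h(2)[OF y] by simp
      fix z assume z: "z \<in> fst ` J" "y \<noteq> z"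
      have "h y \<noteq> h z"
        using h(2)[OF y] h(2)[OF z(1)] z(2) by auto
      then have "R (h y) (h z)"
        using J(3)[OF h(1)[OF y] h(1)[OF z(1)]] by simp
      then show "y \<notin> snd (h z) \<or> z \<notin> snd (h y)"
        using h y z by (simp add: R_def)
    qed
    then show ?thesis
      using J(2) inj countable_image_inj_on by blast
  next
    fix T :: "nat \<Rightarrow> ('g \<times> 'g set) set"
    assume T: "topspace Z = (\<Union>n. T n)" "\<And>n p q. p \<in> T n \<Longrightarrow> q \<in> T n \<Longrightarrow> \<not> R p q"
    show ?thesis
    proof (rule countable_network_imp_cosmic[of _ "\<lambda>n. fst ` T n"])
      fix W and x :: 'g assume W: "openin euclidean W" "x \<in> W"
      then obtain U C where UC: "open U" "closedin M C" "x \<in> U" "U \<subseteq> C" "C \<subseteq> W"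
        using closed_nhd[of W x] by auto
      then have "(x, C) \<in> topspace Z"
        using Z(1) by (auto simp: I_def)
      then obtain n where n: "(x, C) \<in> T n"
        using T(1) by blast
      have "fst p \<in> C" if "p \<in> T n" for p
        using T(2)[OF that n] by (simp add: R_def)
      then have "fst ` T n \<subseteq> W"
        using UC(5) by blast
      then show "\<exists>n. x \<in> fst ` T n \<and> fst ` T n \<subseteq> W"
        using n by force
    next
      have "Hausdorff_space M"
        using M(1) by (rule metrizable_imp_Hausdorff_space)
      then show "Hausdorff_space (euclidean :: 'g topology)"
        unfolding Hausdorff_space_def topspace_euclidean M(2) open_openin[symmetric]
        by (meson M(3))
    qed
  qed
qed

end
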